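(* Let $f\in C^3(\mathbb{R},\mathbb{R})$ satisfy: (i) $xf(x)<0$ for all $x\neq 0$, and $f'(0)<0$; (ii) $f$ is bounded below and has at most one critical point $x^*\in\mathbb{R}$, which (if it exists) is a local extremum of $f$; (iii) $(Sf)(x)<0$ for all $x\in\mathbb{R}$ with $x\neq x^*$ (for all $x\in\mathbb{R}$ if $f$ has no critical point), where $Sf$ is the Schwarz derivative of $f$. If $-f'(0)\le 3/2$, then the steady state solution $x(t)\equiv 0$ of the delay differential equation $$x'(t)=f(x(t-1))$$ is globally attracting, i.e. for every continuous initial function $\gamma:[-1,0]\to\mathbb{R}$ the solution $x(t)$ on $[-1,+\infty)$ with $x(t)=\gamma(t)$ for $t\in[-1,0]$ satisfies $\lim_{t\to+\infty}x(t)=0$.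
   Context: The Schwarz derivative of a $C^3$ function $f$ is $Sf=\dfrac{f'''}{f'}-\dfrac32\left(\dfrac{f''}{f'}\right)^2$, defined where $f'\neq 0$. For each continuous $\gamma:[-1,0]\to\mathbb{R}$ the solution of $x'(t)=f(x(t-1))$, $t\ge 0$, with $x=\gamma$ on $[-1,0]$ is the unique continuous function on $[-1,+\infty)$ that agrees with $\gamma$ on $[-1,0]$ and satisfies the equation for $t\geq 0$ (one-sided derivative at $t=0$); it exists since $f$ is continuous. *)

theory Defs
  imports "HOL-Analysis.Analysis"
begin

definition Ck :: "nat \<Rightarrow> (real \<Rightarrow> real) \<Rightarrow> bool" where
  "Ck k f \<longleftrightarrow>
     (\<forall>j<k. \<forall>x. (deriv ^^ j) f field_differentiable (at x)) \<and>
     continuous_on UNIV ((deriv ^^ k) f)"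

(* Meaningful only where deriv f x is nonzero; elsewhere division by zero gives a junk value. *)
definition schwarz_derivative :: "(real \<Rightarrow> real) \<Rightarrow> real \<Rightarrow> real" where
  "schwarz_derivative f x =
     (deriv ^^ 3) f x / deriv f x - 3 / 2 * ((deriv ^^ 2) f x / deriv f x)\<^sup>2"

definition critical_point :: "(real \<Rightarrow> real) \<Rightarrow> real \<Rightarrow> bool" where
  "critical_point f x \<longleftrightarrow> (f has_real_derivative 0) (at x)"

definition local_extremum :: "(real \<Rightarrow> real) \<Rightarrow> real \<Rightarrow> bool" where
  "local_extremum f x \<longleftrightarrow>
     (\<forall>\<^sub>F y in nhds x. f y \<le> f x) \<or> (\<forall>\<^sub>F y in nhds x. f x \<le> f y)"

(* Solution on [-1, oo) of x'(t) = f (x (t - 1)) with initial function g on [-1, 0]; the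
   values of x below -1 and of g outside [-1, 0] play no role.  The derivative within {0..} is
   the right derivative at t = 0 and the ordinary two-sided one at t > 0. *)
definition dde_solution :: "(real \<Rightarrow> real) \<Rightarrow> (real \<Rightarrow> real) \<Rightarrow> (real \<Rightarrow> real) \<Rightarrow> bool" where
  "dde_solution f g x \<longleftrightarrow>
     continuous_on {-1..} x \<and>
     (\<forall>t\<in>{-1..0}. x t = g t) \<and>
     (\<forall>t\<ge>0. (x has_real_derivative f (x (t - 1))) (at t within {0..}))"

end

theory Submission
  imports Defs
begin

text \<open>
  Negative Schwarz derivative means that \<open>1 / sqrt (- f')\<close> is strictly convex where \<open>f' < 0\<close>. Comparing it
  with its tangent at \<open>0\<close> and integrating, \<open>f x\<close> lies above the Moebius map \<open>f' 0 * x / (1 + c * x)\<close> for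
  \<open>x > 0\<close> and below it for \<open>x < 0\<close> as long as \<open>1 + c * x > 0\<close>, where \<open>c = - f'' 0 / (2 * f' 0)\<close>; the
  slope may then be lowered to \<open>- 3/2\<close>. If \<open>c \<noteq> 0\<close>, rescaling by \<open>c\<close> (with its sign) reduces to \<open>c = 1\<close>,
  where the comparison itself bounds \<open>f\<close> from below. If \<open>c = 0\<close>, the comparison map is linear and exactly
  critical, and the strictness of the comparison decides.

  A solution without arbitrarily late zeros is eventually monotone and tends to \<open>0\<close>. Otherwise every late
  positive maximum follows a zero within one unit of time. If eventually \<open>- m \<le> x\<close>, the slope bound shows how
  far below \<open>0\<close> the solution can have been during the unit of time before that zero, and integrating the comparison map over
  this history bounds the next maximum. The resulting one-dimensional bounds for \<open>limsup x\<close> and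
  \<open>liminf x\<close> are compatible only if both are \<open>0\<close>.
\<close>

subsection \<open>Oscillation and one-step bounds\<close>

text \<open>For \<open>x\<close> eventually bounded above this is \<open>max 0 (limsup x)\<close>.
  The cut at 0 bounds the set from below, so a real-valued \<open>Inf\<close> is meaningful as soon
  as the set is nonempty.\<close>

definition eventual_bound :: "(real \<Rightarrow> real) \<Rightarrow> real" where
  "eventual_bound x = Inf {\<mu>. 0 \<le> \<mu> \<and> eventually (\<lambda>t. x t \<le> \<mu>) at_top}"

lemma eventual_bound_le:
  "0 \<le> \<mu> \<Longrightarrow> eventually (\<lambda>t. x t \<le> \<mu>) at_top \<Longrightarrow> eventual_bound x \<le> \<mu>"
  unfolding eventual_bound_def by (intro cInf_lower) (auto intro: bdd_belowI[of _ 0])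

lemma eventual_bound_nonempty:
  fixes x :: "real \<Rightarrow> real"
  assumes "eventually (\<lambda>t. x t \<le> C) at_top"
  shows "{\<mu>. 0 \<le> \<mu> \<and> eventually (\<lambda>t. x t \<le> \<mu>) at_top} \<noteq> {}"
proof -
  have "eventually (\<lambda>t. x t \<le> max 0 C) at_top"
    using assms by eventually_elim (simp add: le_max_iff_disj)
  then show ?thesis by (auto intro!: exI[of _ "max 0 C"])
qed

lemma eventual_bound_nonneg:
  "eventually (\<lambda>t. x t \<le> C) at_top \<Longrightarrow> 0 \<le> eventual_bound x"
  unfolding eventual_bound_def by (intro cInf_greatest eventual_bound_nonempty) auto

lemma eventually_le_of_eventual_bound:
  assumes "eventually (\<lambda>t. x t \<le> C) at_top" "eventual_bound x < \<mu>"
  shows "eventually (\<lambda>t. x t \<le> \<mu>) at_top"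
proof -
  obtain \<mu>' where "\<mu>' < \<mu>" "eventually (\<lambda>t. x t \<le> \<mu>') at_top"
    using cInf_lessD[OF eventual_bound_nonempty[OF assms(1)] assms(2)[unfolded eventual_bound_def]] by auto
  then show ?thesis by (auto elim: eventually_mono)
qed

lemma tendsto_zero_of_eventual_bound:
  assumes "eventually (\<lambda>t. x t \<le> C) at_top" "eventually (\<lambda>t. - x t \<le> C) at_top"
    and "eventual_bound x = 0" "eventual_bound (\<lambda>t. - x t) = 0"
  shows "(x \<longlongrightarrow> 0) at_top"
proof (rule order_tendstoI)
  show "eventually (\<lambda>t. x t < a) at_top" if "0 < a" for a
    using eventually_le_of_eventual_bound[OF assms(1), of "a / 2"] assms(3) that
    by (auto elim!: eventually_mono)
  show "eventually (\<lambda>t. a < x t) at_top" if "a < 0" for a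
    using eventually_le_of_eventual_bound[OF assms(2), of "- a / 2"] assms(4) that
    by (auto elim!: eventually_mono)
qed

section \<open>The delay equation and solutions without late zeros\<close>

locale delay_equation =
  fixes g x :: "real \<Rightarrow> real"
  assumes continuous: "continuous_on UNIV g"
    and feedbackward: "y \<noteq> 0 \<Longrightarrow> y * g y < 0"
    and deriv: "0 < t \<Longrightarrow> (x has_real_derivative g (x (t - 1))) (at t)"
begin

text \<open>A negative \<open>c\<close> exchanges maxima and minima; with \<open>c = - 1\<close>
  every upper estimate yields the corresponding lower one.\<close>

lemma scale:
  assumes "c \<noteq> 0"
  shows "delay_equation (\<lambda>y. c * g (y / c)) (\<lambda>t. c * x t)"
proof
  show "continuous_on UNIV (\<lambda>y. c * g (y / c))"
    by (intro continuous_intros continuous_on_compose2[OF continuous]) (use assms in auto)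
  show "y * (c * g (y / c)) < 0" if "y \<noteq> 0" for y
  proof -
    have "y * (c * g (y / c)) = c\<^sup>2 * (y / c * g (y / c))"
      using assms by (simp add: power2_eq_square)
    also have "\<dots> < 0"
      using feedbackward[of "y / c"] assms that by (simp add: mult_less_0_iff del: times_divide_eq_left)
    finally show ?thesis .
  qed
  show "((\<lambda>t. c * x t) has_real_derivative c * g (c * x (t - 1) / c)) (at t)" if "0 < t" for t
    using DERIV_cmult[OF deriv[OF that], of c] assms by simp
qed

lemma negate: "delay_equation (\<lambda>y. - g (- y)) (\<lambda>t. - x t)"
  using scale[of "- 1"] by simp

lemma g_neg: "0 < y \<Longrightarrow> g y < 0"
  using feedbackward[of y] by (auto simp: mult_less_0_iff)

lemma g_pos: "y < 0 \<Longrightarrow> 0 < g y"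
  using feedbackward[of y] by (auto simp: mult_less_0_iff)

lemma g_tendsto: "(g \<longlongrightarrow> g y) (at y)"
  using continuous by (simp add: continuous_on_eq_continuous_at isCont_def)

lemma g_zero: "g 0 = 0"
proof (rule antisym)
  have "eventually (\<lambda>y. g y \<le> 0) (at_right (0::real))" "eventually (\<lambda>y. 0 \<le> g y) (at_left (0::real))"
    by (auto simp: eventually_at_filter intro!: always_eventually less_imp_le[OF g_neg] less_imp_le[OF g_pos])
  then show "g 0 \<le> 0" "0 \<le> g 0"
    using g_tendsto[of 0]
    by (auto simp: filterlim_at_split intro: tendsto_upperbound tendsto_lowerbound)
qed

lemma x_continuous: "0 < a \<Longrightarrow> continuous_on {a..b} x"
  by (intro continuous_at_imp_continuous_on ballI DERIV_isCont[OF deriv]) auto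

lemma increment_le:
  assumes "0 < a" "a \<le> b"
    and "\<And>t. a \<le> t \<Longrightarrow> t \<le> b \<Longrightarrow> (H has_real_derivative h t) (at t)"
    and "\<And>t. a \<le> t \<Longrightarrow> t \<le> b \<Longrightarrow> g (x (t - 1)) \<le> h t"
  shows "x b - x a \<le> H b - H a"
proof -
  have "x b - H b \<le> x a - H a"
    using assms
    by (intro DERIV_nonpos_imp_nonincreasing[where f = "\<lambda>t. x t - H t"])
       (auto intro!: exI[of _ "g (x (_ - 1)) - h _"] derivative_intros deriv)
  then show ?thesis by simp
qed

text \<open>One unit after \<open>T\<close> the delayed value is positive, so \<open>x\<close>
  decreases to some \<open>L \<ge> 0\<close>. If \<open>L > 0\<close>, the slope eventually stays
  below \<open>g L / 2 < 0\<close>, which drives \<open>x\<close> to 0 or below.\<close>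

lemma tendsto_zero_of_pos:
  assumes T: "1 \<le> T" and pos: "\<And>t. T \<le> t \<Longrightarrow> 0 < x t"
  shows "(x \<longlongrightarrow> 0) at_top"
proof -
  have dec: "x t \<le> x s" if "T + 1 \<le> s" "s \<le> t" for s t
    using increment_le[of s t "\<lambda>_. 0" "\<lambda>_. 0"] that T less_imp_le[OF g_neg[OF pos]] by simp
  define L where "L = (INF t\<in>{T + 1..}. x t)"
  have bdd: "bdd_below (x ` {T + 1..})"
    using pos by (intro bdd_belowI[of _ 0]) (auto intro: less_imp_le)
  have L0: "0 \<le> L"
    unfolding L_def using pos by (intro cINF_greatest) (auto intro: less_imp_le)
  have Lle: "L \<le> x t" if "T + 1 \<le> t" for t
    unfolding L_def using that by (intro cINF_lower[OF bdd]) auto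
  have lim: "(x \<longlongrightarrow> L) at_top"
  proof (rule order_tendstoI)
    show "eventually (\<lambda>t. a < x t) at_top" if "a < L" for a
      using eventually_ge_at_top[of "T + 1"] by eventually_elim (use Lle that in fastforce)
    show "eventually (\<lambda>t. x t < a) at_top" if "L < a" for a
    proof -
      obtain s where "T + 1 \<le> s" "x s < a"
        using cInf_lessD[OF _ \<open>L < a\<close>[unfolded L_def]] by auto
      then show ?thesis
        using dec by (intro eventually_at_top_linorderI[of s]) (meson le_less_trans)
    qed
  qed
  have "L = 0"
  proof (rule ccontr)
    assume "L \<noteq> 0"
    then have neg: "g L < 0" using L0 g_neg by simp
    have "((\<lambda>t. g (x t)) \<longlongrightarrow> g L) at_top"
      using continuous lim by (intro isCont_tendsto_compose[of _ g])
        (auto simp: continuous_on_eq_continuous_at)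
    then have "eventually (\<lambda>t. g (x t) < g L / 2) at_top"
      using neg by (intro order_tendstoD) auto
    then obtain S where S: "\<And>t. S \<le> t \<Longrightarrow> g (x t) < g L / 2"
      by (auto simp: eventually_at_top_linorder)
    define s where "s = max S T + 1"
    have "x t - x s \<le> g L / 2 * t - g L / 2 * s" if "s \<le> t" for t
      using that T S unfolding s_def
      by (intro increment_le[where h = "\<lambda>_. g L / 2"])
         (auto intro!: derivative_eq_intros less_imp_le)
    \<comment> \<open>The time at which the line through \<open>(s, x s)\<close> with slope
      \<open>g L / 2\<close> reaches 0.\<close>
    moreover define t where "t = s - 2 * x s / g L"
    have "0 < x s" using pos[of s] by (simp add: s_def)
    then have "s \<le> t" using neg by (simp add: t_def divide_nonneg_neg)
    moreover have "g L / 2 * t - g L / 2 * s = - x s" using neg by (simp add: t_def field_simps)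
    moreover have "0 < x t" using \<open>s \<le> t\<close> by (intro pos) (simp add: s_def)
    ultimately show False by fastforce
  qed
  with lim show ?thesis by simp
qed

text \<open>Take \<open>s\<close> to be a maximum point on \<open>{z..t}\<close>. A positive
  \<open>x (s - 1)\<close> would make the slope at \<open>s\<close> negative and \<open>x\<close>
  larger just before \<open>s\<close>. So \<open>x (s - 1) \<le> 0\<close> whenever
  \<open>s - 1 \<ge> z\<close>, and a zero lies in the last unit of time; otherwise \<open>z\<close>
  itself is close enough.\<close>

lemma excursion:
  assumes "1 \<le> z" "x z = 0" "z \<le> t" "0 < x t"
  obtains w s where "z \<le> w" "w \<le> s" "s \<le> w + 1" "x w = 0" "x t \<le> x s"
proof -
  obtain s where s: "s \<in> {z..t}" "\<And>u. u \<in> {z..t} \<Longrightarrow> x u \<le> x s"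
    using continuous_attains_sup[of "{z..t}" x] x_continuous[of z t] assms by auto
  then have "x t \<le> x s" using assms by simp
  moreover have "s \<noteq> z" using calculation assms by auto
  ultimately have xs: "0 < x s" "x t \<le> x s" "z < s"
    using assms s(1) by force+
  have "x (s - 1) \<le> 0"
  proof (rule ccontr)
    assume "\<not> x (s - 1) \<le> 0"
    then have "g (x (s - 1)) < 0" using g_neg by simp
    from DERIV_neg_dec_left[OF deriv this] obtain d where
      d: "0 < d" "\<And>h. 0 < h \<Longrightarrow> h < d \<Longrightarrow> x s < x (s - h)"
      using xs assms by auto
    \<comment> \<open>Small enough for the local decrease and for \<open>s - h\<close> not to pass
      \<open>z\<close>.\<close>
    define h where "h = min (d / 2) (s - z)"
    have "x s < x (s - h)" using d xs by (auto simp: h_def)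
    moreover have "s - h \<in> {z..t}" using d s xs by (auto simp: h_def)
    ultimately show False using s(2) by fastforce
  qed
  show ?thesis
  proof (cases "s - 1 < z")
    case True
    then show ?thesis using that[of z s] xs assms by auto
  next
    case False
    then obtain w where "s - 1 \<le> w" "w \<le> s" "x w = 0"
      using IVT'[of x "s - 1" 0 s] \<open>x (s - 1) \<le> 0\<close> xs x_continuous[of "s - 1" s] assms by auto
    then show ?thesis using that[of w s] False xs by auto
  qed
qed

end

text \<open>Without late zeros the sign is eventually constant by the intermediate value theorem;
  the negative case is the positive one for \<open>- x\<close>.\<close>

lemma (in delay_equation) tendsto_zero_or_zeros:
  "(x \<longlongrightarrow> 0) at_top \<or> (\<forall>T. \<exists>t\<ge>T. x t = 0)"
proof (rule disjCI)
  interpret neg: delay_equation "\<lambda>y. - g (- y)" "\<lambda>t. - x t" by (rule negate)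
  assume "\<not> (\<forall>T. \<exists>t\<ge>T. x t = 0)"
  then obtain T0 where T0: "\<And>t. T0 \<le> t \<Longrightarrow> x t \<noteq> 0" by auto
  define T where "T = max T0 1"
  have T: "1 \<le> T" "\<And>t. T \<le> t \<Longrightarrow> x t \<noteq> 0" using T0 by (auto simp: T_def)
  show "(x \<longlongrightarrow> 0) at_top"
  proof (cases "0 < x T")
    case True
    have "0 < x t" if "T \<le> t" for t
      using IVT2'[of x t 0 T] T that True x_continuous[of T t] by force
    then show ?thesis using tendsto_zero_of_pos T by blast
  next
    case False
    have "0 < - x t" if "T \<le> t" for t
      using IVT'[of x T 0 t] T that False x_continuous[of T t] by force
    then show ?thesis using neg.tendsto_zero_of_pos[of T] T using tendsto_minus_cancel_left[of x 0 at_top] by simp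
  qed
qed

section \<open>Solutions with arbitrarily late zeros\<close>

locale oscillating_delay_equation = delay_equation +
  assumes zeros: "\<exists>t\<ge>T. x t = 0"
begin

lemma scale_oscillating:
  "c \<noteq> 0 \<Longrightarrow> oscillating_delay_equation (\<lambda>y. c * g (y / c)) (\<lambda>t. c * x t)"
  using zeros by (simp add: oscillating_delay_equation_def oscillating_delay_equation_axioms_def scale)

lemma negate_oscillating: "oscillating_delay_equation (\<lambda>y. - g (- y)) (\<lambda>t. - x t)"
  using scale_oscillating[of "- 1"] by simp

text \<open>By \<open>excursion\<close>, each late positive value is dominated by one taken at most
  one unit of time after a zero.\<close>

lemma eventually_le_of_zero:
  assumes "1 \<le> T" "0 \<le> C"
    and "\<And>w s. T \<le> w \<Longrightarrow> w \<le> s \<Longrightarrow> s \<le> w + 1 \<Longrightarrow> x w = 0 \<Longrightarrow> x s \<le> C"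
  shows "eventually (\<lambda>t. x t \<le> C) at_top"
proof -
  obtain z where z: "T \<le> z" "x z = 0" using zeros by blast
  have "x t \<le> C" if "z \<le> t" for t
  proof (cases "0 < x t")
    case True
    obtain w s where "z \<le> w" "w \<le> s" "s \<le> w + 1" "x w = 0" "x t \<le> x s"
      by (rule excursion[of z t]) (use z \<open>z \<le> t\<close> assms True in auto)
    then show ?thesis using assms(3)[of w s] z by auto
  qed (use assms in auto)
  then show ?thesis by (auto simp: eventually_at_top_linorder)
qed

text \<open>The same \<open>C\<close> serves as slope and as height because the rise from a zero
  lasts at most one unit of time.\<close>

lemma eventually_le_of_slope:
  assumes "0 \<le> C" "eventually (\<lambda>t. g (x t) \<le> C) at_top"
  shows "eventually (\<lambda>t. x t \<le> C) at_top"
proof -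
  obtain T where T: "\<And>t. T \<le> t \<Longrightarrow> g (x t) \<le> C"
    using assms by (auto simp: eventually_at_top_linorder)
  show ?thesis
  proof (rule eventually_le_of_zero[of "max 1 (T + 1)"])
    fix w s assume *: "max 1 (T + 1) \<le> w" "w \<le> s" "s \<le> w + 1" "x w = 0"
    have "x s - x w \<le> C * s - C * w"
      using * T by (intro increment_le[where h = "\<lambda>_. C"]) (auto intro!: derivative_eq_intros)
    also have "\<dots> \<le> C" using * assms mult_left_mono[of s "w + 1" C] by (simp add: algebra_simps)
    finally show "x s \<le> C" using * by simp
  qed (use assms in auto)
qed

text \<open>Going back from a zero \<open>w\<close>, the solution satisfies \<open>x (w - d) \<ge> - min \<mu> (P * d)\<close>; the bound is the
  integral of \<open>q (min \<mu> (P * d))\<close> over \<open>0 \<le> d \<le> 1\<close>.\<close>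
lemma eventual_bound_le_of_lower_bound:
  assumes below: "eventually (\<lambda>t. - \<mu> \<le> x t) at_top" and P: "0 < P" "\<And>y. 0 \<le> y \<Longrightarrow> y \<le> \<mu> \<Longrightarrow> g (- y) \<le> P"
    and q: "\<And>y. 0 \<le> y \<Longrightarrow> y \<le> \<mu> \<Longrightarrow> g (- y) \<le> q y" "q 0 = 0" "mono_on {0..\<mu>} q"
    and Q: "\<And>y. 0 \<le> y \<Longrightarrow> y \<le> \<mu> \<Longrightarrow> (Q has_real_derivative q y) (at y)" "Q 0 = 0"
    and \<nu>: "0 < \<mu>" "\<nu> = min \<mu> P"
  shows "eventual_bound x \<le> q \<nu> * (1 - \<nu> / P) + Q \<nu> / P"
proof -
  obtain T where T: "\<And>t. T \<le> t \<Longrightarrow> - \<mu> \<le> x t"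
    using below by (auto simp: eventually_at_top_linorder)
  have q0: "0 \<le> q y" if "0 \<le> y" "y \<le> \<mu>" for y
    using mono_onD[OF q(3), of 0 y] that q(2) by auto
  \<comment> \<open>Here \<open>z\<close> may be negative: positive values of \<open>x\<close> give
    negative feedback, which lies below \<open>q y \<ge> 0\<close>.\<close>
  have gq: "g (- z) \<le> q y" if "z \<le> y" "0 \<le> y" "y \<le> \<mu>" for y z
  proof (cases "0 \<le> z")
    case True
    then show ?thesis using q(1)[of z] mono_onD[OF q(3), of z y] that by auto
  next
    case False
    then show ?thesis using g_neg[of "- z"] q0[of y] that by auto
  qed
  have slope: "g (x t) \<le> P" if "T \<le> t" for t
    using P(2)[of "- x t"] T[OF that] g_neg[of "x t"] P(1) by (cases "x t \<le> 0") auto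
  \<comment> \<open>Length of the stretch before a zero on which the ramp \<open>P * d\<close> stays
    below \<open>\<nu>\<close>; at most 1 since \<open>\<nu> \<le> P\<close>.\<close>
  define \<tau> where "\<tau> = \<nu> / P"
  have \<tau>: "0 \<le> \<tau>" "\<tau> \<le> 1" "P * \<tau> = \<nu>" "0 < \<nu>" "\<nu> \<le> \<mu>" using \<nu> P(1) by (auto simp: \<tau>_def)
  have Qmono: "Q y \<le> Q z" if "0 \<le> y" "y \<le> z" "z \<le> \<mu>" for y z
    using \<open>y \<le> z\<close>
  proof (rule DERIV_nonneg_imp_nondecreasing)
    fix v assume "y \<le> v" "v \<le> z"
    then show "\<exists>d. (Q has_real_derivative d) (at v) \<and> 0 \<le> d"
      using Q(1)[of v] q0[of v] that by auto
  qed
  have nonneg: "0 \<le> q \<nu> * (1 - \<nu> / P) + Q \<nu> / P"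
    using q0[of \<nu>] \<tau> P(1) Qmono[of 0 \<nu>] Q(2) by (auto simp: \<tau>_def)
  show ?thesis
  proof (intro eventual_bound_le[OF nonneg] eventually_le_of_zero[of "max 2 (T + 2)", OF _ nonneg])
    \<comment> \<open>Two units of reserve after \<open>T\<close>: the history reaches one unit
      behind \<open>w\<close>, and its slope looks back one unit more.\<close>
    fix w s assume ws: "max 2 (T + 2) \<le> w" "w \<le> s" "s \<le> w + 1" "x w = 0"
    have backward: "- P * (w - v) \<le> x v" if "w - 1 \<le> v" "v \<le> w" for v
    proof -
      have "x w - x v \<le> P * w - P * v"
        using that slope ws by (intro increment_le[where h = "\<lambda>_. P"]) (auto intro!: derivative_eq_intros)
      then show ?thesis using ws by (simp add: algebra_simps)
    qed
    \<comment> \<open>Up to time \<open>w + 1 - \<tau>\<close> only the constant bound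
      \<open>\<nu>\<close> on the delayed depth is used.\<close>
    have phase1: "x u \<le> q \<nu> * (u - w)" if "w \<le> u" "u \<le> w + 1 - \<tau>" for u
    proof -
      have "x u - x w \<le> q \<nu> * u - q \<nu> * w"
      proof (rule increment_le[where h = "\<lambda>_. q \<nu>"])
        fix t assume t: "w \<le> t" "t \<le> u"
        then have "P * (w - (t - 1)) \<le> P * 1" using P(1) by (intro mult_left_mono) auto
        then have "- x (t - 1) \<le> \<nu>"
          using backward[of "t - 1"] T[of "t - 1"] ws t that \<tau>(1) \<nu>(2) by auto
        then show "g (x (t - 1)) \<le> q \<nu>" using gq[of "- x (t - 1)" \<nu>] \<tau> by auto
      qed (use ws that in \<open>auto intro!: derivative_eq_intros\<close>)
      then show ?thesis using ws by (simp add: algebra_simps)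
    qed
    show "x s \<le> q \<nu> * (1 - \<nu> / P) + Q \<nu> / P"
    proof (cases "s \<le> w + 1 - \<tau>")
      case True
      then have "q \<nu> * (s - w) \<le> q \<nu> * (1 - \<tau>)" using q0[of \<nu>] \<tau> by (intro mult_left_mono) auto
      moreover have "0 \<le> Q \<nu> / P" using Qmono[of 0 \<nu>] \<tau> P(1) Q(2) by simp
      ultimately show ?thesis using phase1[OF ws(2) True] by (simp add: \<tau>_def)
    next
      case False
      define u where "u = w + 1 - \<tau>"
      have u: "w \<le> u" "u \<le> s" "0 < u" using False \<tau> ws by (auto simp: u_def)
      have rng: "0 \<le> P * (w + 1 - t)" "P * (w + 1 - t) \<le> \<mu>" if "u \<le> t" "t \<le> s" for t
      proof -
        show "0 \<le> P * (w + 1 - t)" using P(1) that ws by simp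
        have "P * (w + 1 - t) \<le> P * \<tau>" using P(1) that by (intro mult_left_mono) (auto simp: u_def)
        then show "P * (w + 1 - t) \<le> \<mu>" using \<tau> by simp
      qed
      \<comment> \<open>Afterwards the delayed depth is at most the ramp
        \<open>P * (w + 1 - t)\<close>; \<open>q\<close> of it is integrated exactly, and the
        nonnegative \<open>Q\<close> term at \<open>s\<close> is dropped later.\<close>
      have "x s - x u \<le> - Q (P * (w + 1 - s)) / P - (- Q (P * (w + 1 - u)) / P)"
      proof (rule increment_le[where h = "\<lambda>t. q (P * (w + 1 - t))"])
        fix t assume t: "u \<le> t" "t \<le> s"
        show "((\<lambda>t. - Q (P * (w + 1 - t)) / P) has_real_derivative q (P * (w + 1 - t))) (at t)"
          using P(1) by (auto intro!: derivative_eq_intros DERIV_chain2[OF Q(1)] rng t)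
        show "g (x (t - 1)) \<le> q (P * (w + 1 - t))"
          using gq[of "- x (t - 1)" "P * (w + 1 - t)"] rng[OF t] backward[of "t - 1"] t u ws
          by (auto simp: algebra_simps)
      qed (use u in auto)
      moreover have "0 \<le> Q (P * (w + 1 - s))" using Qmono[of 0] rng[of s] u Q(2) by simp
      moreover have "P * (w + 1 - u) = \<nu>" using \<tau> by (simp add: u_def)
      moreover have "x u \<le> q \<nu> * (1 - \<tau>)" using phase1[of u] u by (simp add: u_def)
      ultimately show ?thesis using P(1) by (simp add: \<tau>_def field_simps)
    qed
  qed simp
qed

end

subsection \<open>Elementary inequalities and Moebius comparison\<close>

lemma moebius_deriv:
  fixes a k y :: real
  assumes "a + k * y \<noteq> 0"
  shows "((\<lambda>y. y / (a + k * y)) has_real_derivative a / (a + k * y)\<^sup>2) (at y)"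
  using assms by (auto intro!: derivative_eq_intros simp: power2_eq_square field_simps)

text \<open>Times \<open>(1 + y) / \<bar>y\<bar>\<close>, this is the amount by which
  \<open>3 * \<bar>y\<bar> / (3 + 4 * y)\<close> exceeds the one-step bound for the Moebius
  comparison with \<open>\<nu> = \<mu> = \<bar>y\<bar>\<close>; the sign of \<open>y\<close> tells
  which extremum is being bounded.\<close>

definition log_gap :: "real \<Rightarrow> real" where
  "log_gap y = ln (1 + y) - y / (1 + y) * (1 + 3/2 * (y / (1 + y)) - 3 * (y / (3 + 4 * y)))"

lemma log_gap_deriv:
  assumes "- 3/4 < y"
  shows "(log_gap has_real_derivative y ^ 3 * (13 + 16 * y) / ((1 + y) ^ 3 * (3 + 4 * y)\<^sup>2)) (at y)"
proof -
  have nz: "1 + y \<noteq> 0" "3 + 4 * y \<noteq> 0" "0 < 1 + y" using assms by auto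
  have l: "((\<lambda>y. ln (1 + y)) has_real_derivative 1 / (1 + y)) (at y)"
    using nz by (auto intro!: derivative_eq_intros)
  have r: "((\<lambda>y. y / (1 + y)) has_real_derivative 1 / (1 + y)\<^sup>2) (at y)"
    using moebius_deriv[of 1 1 y] nz by simp
  have s: "((\<lambda>y. y / (3 + 4 * y)) has_real_derivative 3 / (3 + 4 * y)\<^sup>2) (at y)"
    using moebius_deriv[of 3 4 y] nz by simp
  show ?thesis
    unfolding log_gap_def[abs_def]
    by (rule DERIV_cong[OF DERIV_diff[OF l DERIV_mult[OF r DERIV_diff[OF
          DERIV_add[OF DERIV_const DERIV_cmult[OF r]] DERIV_cmult[OF s]]]]])
      (use nz in \<open>simp add: divide_simps, algebra\<close>)
qed

text \<open>\<open>log_gap 0 = 0\<close>, and the derivative has the sign of \<open>y ^ 3\<close>,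
  since \<open>13 + 16 * y > 1\<close> for \<open>y > - 3/4\<close>.\<close>

lemma log_gap_pos:
  assumes "- 3/4 < y" "y \<noteq> 0"
  shows "0 < log_gap y"
proof -
  have sgn: "0 < (13 + 16 * v) / ((1 + v) ^ 3 * (3 + 4 * v)\<^sup>2)" if "- 3/4 < v" for v :: real
    using that by (intro divide_pos_pos mult_pos_pos) auto
  have "log_gap 0 < log_gap y"
  proof (cases "0 < y")
    case True
    then show ?thesis
    proof (rule DERIV_pos_imp_increasing_open)
      show "\<exists>d. (log_gap has_real_derivative d) (at v) \<and> 0 < d" if "0 < v" "v < y" for v
        using log_gap_deriv[of v] mult_pos_pos[of "v ^ 3", OF _ sgn[of v]] that
        by (auto intro!: exI)
      show "continuous_on {0..y} log_gap"
        using assms by (intro continuous_at_imp_continuous_on ballI DERIV_isCont[OF log_gap_deriv]) auto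
    qed
  next
    case False
    then have "y < 0" using assms by simp
    then show ?thesis
    proof (rule DERIV_neg_imp_decreasing_open)
      show "\<exists>d. (log_gap has_real_derivative d) (at v) \<and> d < 0" if "y < v" "v < 0" for v
        using log_gap_deriv[of v] mult_neg_pos[of "v ^ 3", OF _ sgn[of v]] that assms
        by (auto intro!: exI)
      show "continuous_on {y..0} log_gap"
        using assms by (intro continuous_at_imp_continuous_on ballI DERIV_isCont[OF log_gap_deriv]) auto
    qed
  qed
  then show ?thesis by (simp add: log_gap_def)
qed

text \<open>Serves the regime \<open>\<nu> = P\<close> of the one-step bound. The difference
  \<open>k\<close> of the two sides is nondecreasing from \<open>1/2\<close>, where the regimes meet
  and \<open>k\<close> equals \<open>log_gap (1/2) > 0\<close>.\<close>

lemma log_large_bound: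
  fixes y :: real
  assumes "1/2 \<le> y"
  shows "y / (1 + y) * (3/2 - 3 * (y / (3 + 4 * y))) < ln (1 + 3/2 * (y / (1 + y)))"
proof -
  define k where "k y = ln (1 + (5/2) * y) - ln (1 + y) - y / (1 + y) * (3/2 - 3 * (y / (3 + 4 * y)))" for y :: real
  have "k (1/2) \<le> k y"
  proof (rule DERIV_nonneg_imp_nondecreasing[OF assms])
    fix v :: real assume v: "1/2 \<le> v" "v \<le> y"
    have nz: "1 + v \<noteq> 0" "3 + 4 * v \<noteq> 0" "2 + 5 * v \<noteq> 0" "0 < 1 + v" "0 < 1 + (5/2) * v" using v by auto
    have l: "((\<lambda>v. ln (1 + (5/2) * v) - ln (1 + v)) has_real_derivative 5 / (2 + 5 * v) - 1 / (1 + v)) (at v)"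
      using nz by (auto intro!: derivative_eq_intros simp: field_simps)
    have r: "((\<lambda>v. v / (1 + v)) has_real_derivative 1 / (1 + v)\<^sup>2) (at v)"
      using moebius_deriv[of 1 1 v] nz by simp
    have s: "((\<lambda>v. v / (3 + 4 * v)) has_real_derivative 3 / (3 + 4 * v)\<^sup>2) (at v)"
      using moebius_deriv[of 3 4 v] nz by simp
    have "(k has_real_derivative
      v * (33 * v\<^sup>2 + 24 * v - 9/2) / ((1 + v)\<^sup>2 * (3 + 4 * v)\<^sup>2 * (2 + 5 * v))) (at v)"
      unfolding k_def[abs_def]
      by (rule DERIV_cong[OF DERIV_diff[OF l DERIV_mult[OF r DERIV_diff[OF DERIV_const DERIV_cmult[OF s]]]]])
        (use nz in \<open>simp add: divide_simps, algebra\<close>)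
    moreover have "0 \<le> v * (33 * v\<^sup>2 + 24 * v - 9/2) / ((1 + v)\<^sup>2 * (3 + 4 * v)\<^sup>2 * (2 + 5 * v))"
      using v by (intro divide_nonneg_nonneg mult_nonneg_nonneg) (auto simp: add_increasing)
    ultimately show "\<exists>d. (k has_real_derivative d) (at v) \<and> 0 \<le> d" by auto
  qed
  moreover have "k (1/2) = log_gap (1/2)"
    using ln_div[of "9/4" "3/2::real"] by (simp add: k_def log_gap_def)
  ultimately have "0 < k y" using log_gap_pos[of "1/2"] by simp
  moreover have "ln (1 + (5/2) * y) - ln (1 + y) = ln (1 + 3/2 * (y / (1 + y)))"
    using assms by (subst ln_divide_pos[symmetric]) (auto simp: field_simps)
  ultimately show ?thesis by (simp add: k_def)
qed

section \<open>Negative Schwarz derivative and Moebius comparison\<close>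

lemma schwarz_comparison_deriv:
  assumes C3: "Ck 3 f"
    and slope_neg: "deriv f 0 < 0"
    and crit_unique: "\<And>x y. critical_point f x \<Longrightarrow> critical_point f y \<Longrightarrow> x = y"
    and crit_extremum: "\<And>x. critical_point f x \<Longrightarrow> local_extremum f x"
    and schwarz_neg: "\<And>x. \<not> critical_point f x \<Longrightarrow> schwarz_derivative f x < 0"
    and c: "c = - (deriv ^^ 2) f 0 / (2 * deriv f 0)"
    and x: "x \<noteq> 0" "0 < 1 + c * x"
  shows "deriv f 0 / (1 + c * x)\<^sup>2 < deriv f x"
proof (cases "0 \<le> deriv f x")
  case True
  then show ?thesis using slope_neg x by (smt (verit) divide_neg_pos zero_less_power)
next
  case False
  have dj: "((deriv ^^ j) f has_real_derivative (deriv ^^ Suc j) f y) (at y)" if "j < 3" for j y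
    using C3 that by (simp add: Ck_def DERIV_deriv_iff_field_differentiable)
  have d1: "(f has_real_derivative deriv f y) (at y)" for y using dj[of 0] by simp
  have d2: "(deriv f has_real_derivative (deriv ^^ 2) f y) (at y)" for y
    using dj[of 1] by (simp add: numeral_2_eq_2)
  have d3: "((deriv ^^ 2) f has_real_derivative (deriv ^^ 3) f y) (at y)" for y
    using dj[of 2] by (simp add: numeral_3_eq_3 numeral_2_eq_2)
  have crit: "critical_point f y \<longleftrightarrow> deriv f y = 0" for y
    using d1[of y] DERIV_unique unfolding critical_point_def by fastforce
  have cont: "continuous_on A (deriv f)" for A
    by (intro continuous_at_imp_continuous_on ballI DERIV_isCont[OF d2])
  have root: "\<exists>z. a \<le> z \<and> z \<le> b \<and> deriv f z = 0"
    if "a \<le> b" "deriv f a * deriv f b \<le> 0" for a b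
    using IVT'[of "deriv f" a 0 b] IVT2'[of "deriv f" b 0 a] that cont
    by (auto simp: mult_le_0_iff)
  define a b where "a = min 0 x" and "b = max 0 x"
  have ab: "a < b" "a \<le> 0" "a \<le> x" "0 \<le> b" "x \<le> b" "deriv f a < 0" "deriv f b < 0"
    using x slope_neg False by (auto simp: a_def b_def min_def max_def)
  \<comment> \<open>If the slope were nonnegative at \<open>y\<close>, zeros of
    \<open>deriv f\<close> on both sides would coincide at \<open>y\<close> by uniqueness. Then
    \<open>f\<close> strictly decreases on either side of \<open>y\<close>, so this critical point
    is no extremum.\<close>
  have neg: "deriv f y < 0" if y: "a \<le> y" "y \<le> b" for y
  proof (rule ccontr)
    assume "\<not> deriv f y < 0"
    then obtain z1 z2 where "a \<le> z1" "z1 \<le> y" "deriv f z1 = 0" "y \<le> z2" "z2 \<le> b" "deriv f z2 = 0"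
      using root[of a y] root[of y b] y ab by (auto simp: mult_le_0_iff)
    then have fy: "deriv f y = 0" using crit_unique[of z1 z2] crit by force
    have less: "deriv f v < 0" if "a \<le> v" "v \<le> b" "v \<noteq> y" for v
    proof (rule ccontr)
      assume "\<not> deriv f v < 0"
      then have "0 \<le> deriv f v" by simp
      then have "\<exists>z. z \<noteq> y \<and> deriv f z = 0"
        using root[of a v] root[of v b] that ab
          mult_nonpos_nonneg[of "deriv f a" "deriv f v"] mult_nonneg_nonpos[of "deriv f v" "deriv f b"]
        by (cases v y rule: linorder_cases) (auto, (metis not_le)+)
      then obtain z where "z \<noteq> y" "deriv f z = 0" by blast
      then show False using crit_unique[of z y] crit fy by blast
    qed
    have yab: "a < y" "y < b" using y ab fy by (auto simp: less_le)
    have decl: "f y < f v" if "a < v" "v < y" for v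
      using that yab less d1 by (intro DERIV_neg_imp_decreasing_open[of v y f])
        (auto intro!: exI continuous_at_imp_continuous_on DERIV_isCont[OF d1])
    have decr: "f v < f y" if "y < v" "v < b" for v
      using that yab less d1 by (intro DERIV_neg_imp_decreasing_open[of y v f])
        (auto intro!: exI continuous_at_imp_continuous_on DERIV_isCont[OF d1])
    have "local_extremum f y" using crit_extremum crit fy by blast
    then show False
      unfolding local_extremum_def
    proof
      assume "\<forall>\<^sub>F v in nhds y. f v \<le> f y"
      then have "\<forall>\<^sub>F v in at_left y. f v \<le> f y"
        by (auto simp: eventually_at_filter elim: eventually_mono)
      moreover have "\<forall>\<^sub>F v in at_left y. a < v \<and> v < y"
        using yab eventually_at_left_real[of a y] by (auto elim: eventually_mono)
      ultimately have "\<forall>\<^sub>F v in at_left y. False"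
        by eventually_elim (use decl in fastforce)
      then show False by simp
    next
      assume "\<forall>\<^sub>F v in nhds y. f y \<le> f v"
      then have "\<forall>\<^sub>F v in at_right y. f y \<le> f v"
        by (auto simp: eventually_at_filter elim: eventually_mono)
      moreover have "\<forall>\<^sub>F v in at_right y. y < v \<and> v < b"
        using yab eventually_at_right_real[of y b] by (auto elim: eventually_mono)
      ultimately have "\<forall>\<^sub>F v in at_right y. False"
        by eventually_elim (use decr in fastforce)
      then show False by simp
    qed
  qed
  define G where "G y = 1 / sqrt (- deriv f y)" for y
  \<comment> \<open>\<open>G\<close> and its first two derivatives, indexed as \<open>Taylor\<close>
    expects. That \<open>G'' = - (1/2) * Sf * G\<close> is where the Schwarz derivative enters: its
    negativity makes \<open>G\<close> strictly convex.\<close>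
  define D :: "nat \<Rightarrow> real \<Rightarrow> real" where "D m =
    (if m = 0 then G else if m = 1 then (\<lambda>y. - (1/2) * ((deriv ^^ 2) f y / deriv f y) * G y)
     else (\<lambda>y. - (1/2) * schwarz_derivative f y * G y))" for m
  have G1: "(G has_real_derivative - (1/2) * ((deriv ^^ 2) f y / deriv f y) * G y) (at y)"
    if "deriv f y < 0" for y
  proof -
    have "((\<lambda>y. 1 / sqrt (- deriv f y)) has_real_derivative
       - (1/2) * ((deriv ^^ 2) f y / deriv f y) * (1 / sqrt (- deriv f y))) (at y)"
      using that by (auto intro!: derivative_eq_intros d2 simp: divide_simps)
    then show ?thesis by (simp add: G_def[abs_def])
  qed
  have G2: "((\<lambda>y. - (1/2) * ((deriv ^^ 2) f y / deriv f y) * G y) has_real_derivative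
      - (1/2) * schwarz_derivative f y * G y) (at y)" if "deriv f y < 0" for y
    using that unfolding schwarz_derivative_def
    by (auto intro!: derivative_eq_intros d2 d3 G1 simp: divide_simps power2_eq_square algebra_simps)
  have "\<exists>t. (if x < 0 then x < t \<and> t < 0 else 0 < t \<and> t < x) \<and>
      G x = (\<Sum>m<2. D m 0 / fact m * (x - 0) ^ m) + D 2 t / fact 2 * (x - 0) ^ 2"
  proof (rule Taylor[where a = a and b = b])
    show "\<forall>m t. m < 2 \<and> a \<le> t \<and> t \<le> b \<longrightarrow> DERIV (D m) t :> D (Suc m) t"
      using G1 G2 neg by (auto simp: D_def less_2_cases_iff)
  qed (use ab x in \<open>auto simp: D_def\<close>)
  then obtain t where t: "if x < 0 then x < t \<and> t < 0 else 0 < t \<and> t < x"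
    and "G x = (\<Sum>m<2. D m 0 / fact m * (x - 0) ^ m) + D 2 t / fact 2 * (x - 0) ^ 2" by blast
  moreover have "D 0 = G" by (simp add: D_def)
  ultimately have Gx: "G x = G 0 + D 1 0 * x + D 2 t / 2 * x\<^sup>2" by (simp add: numeral_2_eq_2)
  have "a \<le> t" "t \<le> b" using t by (auto simp: a_def b_def split: if_splits)
  have "0 < D 2 t"
    using schwarz_neg[of t] neg[OF \<open>a \<le> t\<close> \<open>t \<le> b\<close>] crit[of t]
    by (auto simp: D_def G_def intro!: mult_neg_pos divide_neg_pos)
  then have "0 < D 2 t / 2 * x\<^sup>2" using x by simp
  \<comment> \<open>This explains \<open>c\<close>: the tangent of \<open>G\<close> at 0 is
    \<open>G 0 * (1 + c * x)\<close>.\<close>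
  moreover have "D 1 0 = c * G 0" using c by (simp add: D_def field_simps)
  ultimately have "G 0 * (1 + c * x) < G x" using Gx by (simp add: algebra_simps)
  moreover have "0 \<le> G 0 * (1 + c * x)" using x slope_neg by (simp add: G_def)
  ultimately have "(G 0 * (1 + c * x))\<^sup>2 < (G x)\<^sup>2" by (intro power_strict_mono) auto
  moreover have "(G 0)\<^sup>2 = 1 / - deriv f 0" "(G x)\<^sup>2 = 1 / - deriv f x"
    using slope_neg False by (auto simp: G_def power_divide)
  ultimately have "(1 + c * x)\<^sup>2 / - deriv f 0 < 1 / - deriv f x"
    by (simp add: power_mult_distrib)
  then show ?thesis using slope_neg False x by (simp add: field_simps)
qed

text \<open>The mean value theorem integrates the slope comparison. Lowering the slope from
  \<open>deriv f 0\<close> to \<open>- 3/2\<close> only adds a nonnegative multiple of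
  \<open>x\<^sup>2 / (1 + c * x)\<close>.\<close>

lemma schwarz_comparison:
  assumes "Ck 3 f" "f 0 = 0" "deriv f 0 < 0" "- deriv f 0 \<le> 3/2"
    and "\<And>x y. critical_point f x \<Longrightarrow> critical_point f y \<Longrightarrow> x = y"
    and "\<And>x. critical_point f x \<Longrightarrow> local_extremum f x"
    and "\<And>x. \<not> critical_point f x \<Longrightarrow> schwarz_derivative f x < 0"
    and "c = - (deriv ^^ 2) f 0 / (2 * deriv f 0)"
    and x: "x \<noteq> 0" "0 < 1 + c * x"
  shows "0 < x * (f x + 3/2 * (x / (1 + c * x)))"
proof -
  have d1: "(f has_real_derivative deriv f y) (at y)" for y
    using assms(1) unfolding Ck_def by (auto simp: DERIV_deriv_iff_field_differentiable dest: spec[of _ 0])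
  define d where "d y = f y - deriv f 0 * (y / (1 + c * y))" for y
  \<comment> \<open>An affine function positive at 0 and at \<open>x\<close> is positive in
    between.\<close>
  have pos: "0 < 1 + c * y" if "min 0 x \<le> y" "y \<le> max 0 x" for y
  proof (cases "0 \<le> c * y")
    case False
    then have "c * x \<le> c * y"
      using that by (auto simp: not_le mult_less_0_iff min_def max_def split: if_splits
        intro: mult_left_mono mult_left_mono_neg)
    then show ?thesis using x by simp
  qed simp
  have dd: "(d has_real_derivative deriv f y - deriv f 0 / (1 + c * y)\<^sup>2) (at y)"
    if "min 0 x \<le> y" "y \<le> max 0 x" for y
    unfolding d_def[abs_def]
    by (rule DERIV_cong[OF DERIV_diff[OF d1 DERIV_cmult[OF moebius_deriv]]]) (use pos[OF that] in auto)
  have "\<exists>z. 0 < deriv f z - deriv f 0 / (1 + c * z)\<^sup>2 \<and> d x = x * (deriv f z - deriv f 0 / (1 + c * z)\<^sup>2)"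
  proof (cases "0 < x")
    case True
    then obtain z where z: "0 < z" "z < x" "d x - d 0 = (x - 0) * (deriv f z - deriv f 0 / (1 + c * z)\<^sup>2)"
      using MVT2[of 0 x d "\<lambda>z. deriv f z - deriv f 0 / (1 + c * z)\<^sup>2"] dd by auto
    then show ?thesis
      using schwarz_comparison_deriv[OF assms(1,3,5-8), of z] pos[of z] assms(2)
      by (intro exI[of _ z]) (auto simp: d_def)
  next
    case False
    then obtain z where z: "x < z" "z < 0" "d 0 - d x = (0 - x) * (deriv f z - deriv f 0 / (1 + c * z)\<^sup>2)"
      using MVT2[of x 0 d "\<lambda>z. deriv f z - deriv f 0 / (1 + c * z)\<^sup>2"] dd x by auto
    then show ?thesis
      using schwarz_comparison_deriv[OF assms(1,3,5-8), of z] pos[of z] assms(2)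
      by (intro exI[of _ z]) (auto simp: d_def)
  qed
  then obtain e where e: "0 < e" "d x = x * e" by blast
  have "x * (f x + 3/2 * (x / (1 + c * x))) = x * d x + x\<^sup>2 * ((deriv f 0 + 3/2) / (1 + c * x))"
    using x by (simp add: d_def algebra_simps add_divide_distrib power2_eq_square)
  moreover have "0 < x * d x" using e x by (cases "0 < x") (simp_all add: mult_neg_neg mult_neg_pos)
  moreover have "0 \<le> x\<^sup>2 * ((deriv f 0 + 3/2) / (1 + c * x))" using assms(4) x by simp
  ultimately show ?thesis by linarith
qed

subsection \<open>Global attraction\<close>

context oscillating_delay_equation
begin

text \<open>The lower bound of \<open>g\<close> limits the fall after a zero, hence eventually
  \<open>x \<ge> - L\<close>. On \<open>{- L..0}\<close> continuity bounds \<open>g\<close> above,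
  which limits the rise.\<close>

lemma bounded:
  assumes "bdd_below (range g)"
  obtains C where "eventually (\<lambda>t. x t \<le> C) at_top" "eventually (\<lambda>t. - x t \<le> C) at_top"
proof -
  interpret neg: oscillating_delay_equation "\<lambda>y. - g (- y)" "\<lambda>t. - x t" by (rule negate_oscillating)
  obtain K where "\<And>y. K \<le> g y" using assms by (auto simp: bdd_below_def)
  then have K: "- g y \<le> max 0 (- K)" for y by (simp add: le_max_iff_disj)
  define L where "L = max 0 (- K)"
  have low: "eventually (\<lambda>t. - x t \<le> L) at_top"
    using neg.eventually_le_of_slope[of L] K by (simp add: L_def)
  obtain v where v: "\<And>y. - L \<le> y \<Longrightarrow> y \<le> 0 \<Longrightarrow> g y \<le> g v"
    using continuous_attains_sup[of "{- L..0}" g] continuous_on_subset[OF continuous, of "{- L..0}"]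
    by (force simp: L_def)
  have "eventually (\<lambda>t. g (x t) \<le> max 0 (g v)) at_top"
    using low
  proof eventually_elim
    case (elim t)
    then show ?case using v[of "x t"] g_neg[of "x t"] by (cases "x t \<le> 0") auto
  qed
  then have "eventually (\<lambda>t. x t \<le> max 0 (g v)) at_top"
    by (intro eventually_le_of_slope) auto
  then have "eventually (\<lambda>t. x t \<le> max L (max 0 (g v))) at_top" by (auto elim!: eventually_mono)
  moreover have "eventually (\<lambda>t. - x t \<le> max L (max 0 (g v))) at_top"
    using low by (auto elim!: eventually_mono)
  ultimately show thesis using that by blast
qed

text \<open>With slope bound \<open>P = 3/2 * \<mu>\<close> the one-step estimate returns exactly
  \<open>\<mu>\<close>. By compactness the strict comparison keeps \<open>g\<close> below some
  \<open>P < 3/2 * m\<close> on \<open>{- m..0}\<close>, and this smaller \<open>P\<close> gives a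
  bound below \<open>m\<close>.\<close>

lemma eventual_bound_less_of_linear:
  assumes lin: "\<And>y. y < 0 \<Longrightarrow> g y < - (3/2) * y" and C: "eventually (\<lambda>t. - x t \<le> C) at_top"
    and m: "m = eventual_bound (\<lambda>t. - x t)"
  shows "eventual_bound x \<le> m" "0 < m \<Longrightarrow> eventual_bound x < m"
proof -
  have bound: "eventual_bound x \<le> 3/2 * \<mu> * (1 - \<mu> / P) + 3/4 * \<mu>\<^sup>2 / P"
    if "m < \<mu>" "0 < \<mu>" "\<mu> \<le> P" "\<And>y. 0 \<le> y \<Longrightarrow> y \<le> \<mu> \<Longrightarrow> g (- y) \<le> P" for \<mu> P
  proof (rule eventual_bound_le_of_lower_bound[where \<mu> = \<mu>])
    show "eventually (\<lambda>t. - \<mu> \<le> x t) at_top"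
      using eventually_le_of_eventual_bound[OF C] that(1) m by (simp add: minus_le_iff)
    show "mono_on {0..\<mu>} (\<lambda>y. 3/2 * y)" by (auto intro: mono_onI)
    show "g (- y) \<le> 3/2 * y" if "0 \<le> y" "y \<le> \<mu>" for y
      using lin[of "- y"] g_zero that by (cases "y = 0") auto
    show "((\<lambda>y. 3/4 * y\<^sup>2) has_real_derivative 3/2 * y) (at y)" for y :: real
      by (auto intro!: derivative_eq_intros)
  qed (use that in auto)
  have m0: "0 \<le> m" unfolding m by (rule eventual_bound_nonneg[OF C])
  have simple: "eventual_bound x \<le> \<mu>" if "m < \<mu>" for \<mu>
  proof -
    have "g (- y) \<le> 3/2 * \<mu>" if "0 \<le> y" "y \<le> \<mu>" for y
      using lin[of "- y"] g_zero that by (cases "y = 0") auto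
    then show ?thesis
      using bound[of \<mu> "3/2 * \<mu>"] that m0 by (simp add: power2_eq_square)
  qed
  then show "eventual_bound x \<le> m" by (rule dense_ge)
  assume "0 < m"
  have "continuous_on {0..m} (\<lambda>y. g (- y))"
    by (intro continuous_on_compose2[OF continuous] continuous_intros) auto
  then obtain y0 where y0: "0 \<le> y0" "y0 \<le> m" "\<And>y. 0 \<le> y \<Longrightarrow> y \<le> m \<Longrightarrow> g (- y) \<le> g (- y0)"
    using continuous_attains_sup[of "{0..m}" "\<lambda>y. g (- y)"] m0 by fastforce
  have P0: "g (- y0) < 3/2 * m"
    using lin[of "- y0"] g_zero y0 \<open>0 < m\<close> by (cases "y0 = 0") auto
  \<comment> \<open>Strictly between the maximal feedback and \<open>3/2 * m\<close>; the
    alternative \<open>5/4 * m\<close> guarantees \<open>\<mu> \<le> P\<close> for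
    \<open>\<mu>\<close> slightly above \<open>m\<close>.\<close>
  define P where "P = max ((g (- y0) + 3/2 * m) / 2) (5/4 * m)"
  have P: "g (- y0) < P" "P < 3/2 * m" "5/4 * m \<le> P" "0 < P"
    using P0 \<open>0 < m\<close> unfolding P_def by (auto simp: max_def field_simps)
  \<comment> \<open>The eventual lower bound is available only for \<open>\<mu> > m\<close>, so the
    slope bound must extend a little below \<open>- m\<close>.\<close>
  have "eventually (\<lambda>v. g v < P) (at (- m))"
    using P y0(3)[of m] m0 by (intro order_tendstoD(2)[OF g_tendsto]) auto
  then obtain d where d: "0 < d" "\<And>v. v \<noteq> - m \<Longrightarrow> \<bar>v + m\<bar> < d \<Longrightarrow> g v < P"
    by (auto simp: eventually_at dist_real_def)
  have near: "eventually (\<lambda>\<mu>. eventual_bound x \<le> 3/2 * \<mu> * (1 - \<mu> / P) + 3/4 * \<mu>\<^sup>2 / P) (at_right m)"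
  proof (rule eventually_at_rightI[of m "m + min d (m / 4)"])
    fix \<mu> assume \<mu>: "\<mu> \<in> {m<..<m + min d (m / 4)}"
    show "eventual_bound x \<le> 3/2 * \<mu> * (1 - \<mu> / P) + 3/4 * \<mu>\<^sup>2 / P"
    proof (rule bound)
      fix y assume y: "0 \<le> y" "y \<le> \<mu>"
      show "g (- y) \<le> P"
      proof (cases "y \<le> m")
        case True
        then show ?thesis using y0(3)[of y] y P by simp
      next
        case False
        then show ?thesis using d(2)[of "- y"] y \<mu> by (simp add: less_imp_le)
      qed
    qed (use \<mu> P m0 in auto)
  qed (use d \<open>0 < m\<close> in auto)
  have "((\<lambda>\<mu>. 3/2 * \<mu> * (1 - \<mu> / P) + 3/4 * \<mu>\<^sup>2 / P) \<longlongrightarrow> 3/2 * m * (1 - m / P) + 3/4 * m\<^sup>2 / P) (at_right m)"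
    by (intro tendsto_intros) (use P in auto)
  from tendsto_lowerbound[OF this near]
  have "eventual_bound x \<le> 3/2 * m * (1 - m / P) + 3/4 * m\<^sup>2 / P" by simp
  also have "\<dots> = 3/2 * m - 3/4 * m * (m / P)"
    using P(4) by (simp add: field_simps power2_eq_square)
  also have "\<dots> < m"
  proof -
    have "2/3 < m / P" using P by (simp add: field_simps)
    then have "3/4 * m * (2/3) < 3/4 * m * (m / P)" using \<open>0 < m\<close> by (intro mult_strict_left_mono) auto
    then show ?thesis by simp
  qed
  finally show "eventual_bound x < m" .
qed

text \<open>The preceding estimate for \<open>x\<close> and for \<open>- x\<close> shows each
  eventual bound to be at most the other, strictly so if the other is positive; hence both
  vanish.\<close>

lemma tendsto_zero_of_linear:
  assumes lin: "\<And>y. y \<noteq> 0 \<Longrightarrow> 0 < y * (g y + 3/2 * y)" and "bdd_below (range g)"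
  shows "(x \<longlongrightarrow> 0) at_top"
proof -
  interpret neg: oscillating_delay_equation "\<lambda>y. - g (- y)" "\<lambda>t. - x t" by (rule negate_oscillating)
  obtain C where C: "eventually (\<lambda>t. x t \<le> C) at_top" "eventually (\<lambda>t. - x t \<le> C) at_top"
    using bounded[OF assms(2)] .
  have "g y < - (3/2) * y" "- g (- y) < - (3/2) * y" if "y < 0" for y
    using lin[of y] lin[of "- y"] that by (auto simp: zero_less_mult_iff mult_less_0_iff)
  note * = eventual_bound_less_of_linear[OF this(1) C(2) refl]
    neg.eventual_bound_less_of_linear[OF this(2) _ refl, of C, unfolded minus_minus, OF _ C(1)]
  have "eventual_bound x = 0" "eventual_bound (\<lambda>t. - x t) = 0"
    using * eventual_bound_nonneg[OF C(1)] eventual_bound_nonneg[OF C(2)] by fastforce+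
  then show ?thesis using tendsto_zero_of_eventual_bound[OF C] by blast
qed

text \<open>The map \<open>y \<mapsto> - 3 y / (3 + 4 y)\<close> is an involution that agrees to second order at \<open>0\<close> with the map
  bounding the next extremum, so the two one-sided estimates are incompatible unless both extrema vanish.\<close>
lemma tendsto_zero_of_moebius:
  assumes cmp: "\<And>y. y \<noteq> 0 \<Longrightarrow> 0 < 1 + y \<Longrightarrow> 0 < y * (g y + 3/2 * (y / (1 + y)))"
  shows "(x \<longlongrightarrow> 0) at_top"
proof -
  interpret neg: oscillating_delay_equation "\<lambda>y. - g (- y)" "\<lambda>t. - x t" by (rule negate_oscillating)
  have lo: "- g y \<le> 3/2 * (y / (1 + y))" if "0 \<le> y" for y
    using cmp[of y] g_zero that by (cases "y = 0") (auto simp: zero_less_mult_iff)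
  have up: "g (- y) \<le> 3/2 * (y / (1 - y))" if "0 \<le> y" "y < 1" for y
    using cmp[of "- y"] g_zero that by (cases "y = 0") (auto simp: zero_less_mult_iff mult_less_0_iff)
  have "- (3/2) \<le> g y" for y
  proof (cases "0 \<le> y")
    case True
    then have "y / (1 + y) \<le> 1" by simp
    then show ?thesis using lo[OF True] by linarith
  next
    case False
    then show ?thesis using g_pos[of y] by simp
  qed
  then have "bdd_below (range g)" by (intro bdd_belowI[of _ "- (3/2)"]) auto
  then obtain C where C: "eventually (\<lambda>t. x t \<le> C) at_top" "eventually (\<lambda>t. - x t \<le> C) at_top"
    by (rule bounded)
  define M m where "M = eventual_bound x" and "m = eventual_bound (\<lambda>t. - x t)"
  have nonneg: "0 \<le> M" "0 \<le> m"
    using C by (auto simp: M_def m_def intro: eventual_bound_nonneg)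
  have below: "m \<le> 3 * (\<mu> / (3 + 4 * \<mu>))" if \<mu>: "M < \<mu>" for \<mu>
  proof -
    have pos: "0 < \<mu>" using \<mu> nonneg by simp
    define P where "P = 3/2 * (\<mu> / (1 + \<mu>))"
    define \<nu> where "\<nu> = min \<mu> P"
    have P0: "0 < P" using pos by (simp add: P_def)
    have mono: "mono_on {0..\<mu>} (\<lambda>y. 3/2 * (y / (1 + y)))"
      by (auto intro!: mono_onI simp: frac_le_eq divide_simps algebra_simps)
    have "m \<le> 3/2 * (\<nu> / (1 + \<nu>)) * (1 - \<nu> / P) + 3/2 * (\<nu> - ln (1 + \<nu>)) / P"
      unfolding m_def
    proof (rule neg.eventual_bound_le_of_lower_bound[where \<mu> = \<mu>])
      show "eventually (\<lambda>t. - \<mu> \<le> - x t) at_top"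
        using eventually_le_of_eventual_bound[OF C(1)] \<mu> M_def by simp
      show "- g (- (- y)) \<le> P" if "0 \<le> y" "y \<le> \<mu>" for y
        using lo[of y] mono_onD[OF mono, of y \<mu>] that by (simp add: P_def)
      show "((\<lambda>y. 3/2 * (y - ln (1 + y))) has_real_derivative 3/2 * (y / (1 + y))) (at y)"
        if "0 \<le> y" for y :: real
        using that by (auto intro!: derivative_eq_intros simp: field_simps)
    qed (use lo mono pos P0 \<nu>_def in auto)
    also have "\<dots> \<le> 3 * (\<mu> / (3 + 4 * \<mu>))"
    \<comment> \<open>\<open>\<mu> \<le> P\<close> holds exactly when
      \<open>\<mu> \<le> 1/2\<close>, so the cases decide which term attains
      \<open>\<nu>\<close>.\<close>
    proof (cases "\<mu> \<le> 1/2")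
      case True
      then have "\<nu> = \<mu>" using pos by (auto simp: \<nu>_def P_def field_simps)
      then have "3/2 * (\<nu> / (1 + \<nu>)) * (1 - \<nu> / P) + 3/2 * (\<nu> - ln (1 + \<nu>)) / P
        = 3 * (\<mu> / (3 + 4 * \<mu>)) - (1 + \<mu>) / \<mu> * log_gap \<mu>"
        using pos unfolding \<open>\<nu> = \<mu>\<close> by (simp add: P_def log_gap_def divide_simps) algebra
      moreover have "0 < (1 + \<mu>) / \<mu> * log_gap \<mu>"
        using pos log_gap_pos[of \<mu>] by simp
      ultimately show ?thesis by simp
    next
      case False
      then have "\<nu> = P" using pos by (auto simp: \<nu>_def P_def field_simps)
      have "3/2 * (\<nu> / (1 + \<nu>)) * (1 - \<nu> / P) + 3/2 * (\<nu> - ln (1 + \<nu>)) / P = 3/2 - 3/2 * (ln (1 + P) / P)"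
        using P0 unfolding \<open>\<nu> = P\<close> by (simp add: field_simps)
      \<comment> \<open>The claim is
        \<open>3/2 - 3/2 * (ln (1 + P) / P) \<le> 3/2 - B\<close>.\<close>
      moreover define B where "B = 3/2 - 3 * (\<mu> / (3 + 4 * \<mu>))"
      have "2/3 * B < ln (1 + P) / P"
      proof -
        have "\<mu> / (1 + \<mu>) * B < ln (1 + P)"
          using log_large_bound[of \<mu>] False by (simp add: P_def B_def)
        moreover have "\<mu> / (1 + \<mu>) = P * (2/3)" using pos by (simp add: P_def field_simps)
        ultimately have "P * (2/3 * B) < ln (1 + P)" by (simp only: mult.assoc)
        then show ?thesis
          using P0 by (simp only: pos_less_divide_eq mult.commute)
      qed
      ultimately show ?thesis unfolding B_def by simp
    qed
    finally show ?thesis .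
  qed
  \<comment> \<open>Here \<open>\<mu> \<le> P\<close> throughout, so one regime suffices. The
    \<open>log_gap\<close> term is kept so that strictness survives the limit
    \<open>\<mu> \<rightarrow> m\<close>.\<close>
  have above: "M \<le> 3 * \<mu> / (3 - 4 * \<mu>) - (1 - \<mu>) / \<mu> * log_gap (- \<mu>)" if \<mu>: "m < \<mu>" "\<mu> < 3/4" for \<mu>
  proof -
    have pos: "0 < \<mu>" using \<mu> nonneg by simp
    define P where "P = 3/2 * (\<mu> / (1 - \<mu>))"
    have P0: "\<mu> \<le> P" using pos \<mu> by (simp add: P_def field_simps)
    have mono: "mono_on {0..\<mu>} (\<lambda>y. 3/2 * (y / (1 - y)))"
      using \<mu> by (auto intro!: mono_onI frac_le)
    have "M \<le> 3/2 * (\<mu> / (1 - \<mu>)) * (1 - \<mu> / P) + 3/2 * (- \<mu> - ln (1 - \<mu>)) / P"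
      unfolding M_def
    proof (rule eventual_bound_le_of_lower_bound[where \<mu> = \<mu>])
      show "eventually (\<lambda>t. - \<mu> \<le> x t) at_top"
        using eventually_le_of_eventual_bound[OF C(2)] \<mu> m_def by (simp add: minus_le_iff)
      show "g (- y) \<le> P" if "0 \<le> y" "y \<le> \<mu>" for y
        using up[of y] mono_onD[OF mono, of y \<mu>] that \<mu> by (simp add: P_def)
      show "((\<lambda>y. 3/2 * (- y - ln (1 - y))) has_real_derivative 3/2 * (y / (1 - y))) (at y)"
        if "0 \<le> y" "y \<le> \<mu>" for y :: real
        using that \<mu> by (auto intro!: derivative_eq_intros simp: field_simps)
    qed (use up mono pos P0 \<mu> in auto)
    also have "\<dots> = 3 * \<mu> / (3 - 4 * \<mu>) - (1 - \<mu>) / \<mu> * log_gap (- \<mu>)"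
      using pos \<mu> by (simp add: P_def log_gap_def divide_simps) algebra
    finally show ?thesis .
  qed
  have m_le: "m \<le> 3 * (M / (3 + 4 * M))"
  proof (rule tendsto_lowerbound)
    show "((\<lambda>\<mu>. 3 * (\<mu> / (3 + 4 * \<mu>))) \<longlongrightarrow> 3 * (M / (3 + 4 * M))) (at_right M)"
      by (intro tendsto_intros) (use nonneg in auto)
    show "eventually (\<lambda>\<mu>. m \<le> 3 * (\<mu> / (3 + 4 * \<mu>))) (at_right M)"
      using below by (auto simp: eventually_at_filter)
  qed simp
  have "m * (3 + 4 * M) \<le> 3 * M" using m_le nonneg by (simp add: field_simps)
  \<comment> \<open>The map \<open>3 * M / (3 + 4 * M)\<close> stays below \<open>3/4\<close>, which
    brings \<open>m\<close> into the range of \<open>above\<close>.\<close>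
  have "m < 3/4" using m_le nonneg by (rule_tac le_less_trans[OF m_le]) (simp add: field_simps)
  have "m = 0"
  proof (rule ccontr)
    assume "m \<noteq> 0"
    then have m0: "0 < m" using nonneg by simp
    have "isCont log_gap (- m)" using \<open>m < 3/4\<close> by (intro DERIV_isCont[OF log_gap_deriv]) simp
    then have "((\<lambda>\<mu>. log_gap (- \<mu>)) \<longlongrightarrow> log_gap (- m)) (at_right m)"
      by (rule isCont_tendsto_compose) (intro tendsto_intros)
    then have "((\<lambda>\<mu>. 3 * \<mu> / (3 - 4 * \<mu>) - (1 - \<mu>) / \<mu> * log_gap (- \<mu>)) \<longlongrightarrow>
        3 * m / (3 - 4 * m) - (1 - m) / m * log_gap (- m)) (at_right m)"
      by (intro tendsto_intros) (use m0 \<open>m < 3/4\<close> in auto)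
    moreover have "eventually (\<lambda>\<mu>. M \<le> 3 * \<mu> / (3 - 4 * \<mu>) - (1 - \<mu>) / \<mu> * log_gap (- \<mu>)) (at_right m)"
      using \<open>m < 3/4\<close> above by (intro eventually_at_rightI[of m "3/4"]) auto
    ultimately have "M \<le> 3 * m / (3 - 4 * m) - (1 - m) / m * log_gap (- m)"
      by (rule tendsto_lowerbound) simp
    also have "\<dots> < 3 * m / (3 - 4 * m)"
      using log_gap_pos[of "- m"] m0 \<open>m < 3/4\<close> by simp
    finally have "M * (3 - 4 * m) < 3 * m" using \<open>m < 3/4\<close> by (simp add: field_simps)
    \<comment> \<open>Both inequalities compare \<open>3 * m + 4 * m * M\<close> with
      \<open>3 * M\<close>, in opposite directions and one of them strictly.\<close>
    with \<open>m * (3 + 4 * M) \<le> 3 * M\<close> show False by (simp add: algebra_simps)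
  qed
  \<comment> \<open>At \<open>m = 0\<close> the factor \<open>(1 - \<mu>) / \<mu>\<close> is
    singular; dropping the positive gap leaves a map continuous at 0.\<close>
  have "M \<le> 3 * 0 / (3 - 4 * (0::real))"
  proof (rule tendsto_lowerbound)
    show "((\<lambda>\<mu>::real. 3 * \<mu> / (3 - 4 * \<mu>)) \<longlongrightarrow> 3 * 0 / (3 - 4 * 0)) (at_right 0)"
      by (intro tendsto_intros) auto
    show "eventually (\<lambda>\<mu>. M \<le> 3 * \<mu> / (3 - 4 * \<mu>)) (at_right 0)"
    proof (rule eventually_at_rightI[of 0 "3/4"])
      fix \<mu> :: real assume \<mu>: "\<mu> \<in> {0<..<3/4}"
      then have "0 < (1 - \<mu>) / \<mu> * log_gap (- \<mu>)" using log_gap_pos[of "- \<mu>"] by simp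
      then show "M \<le> 3 * \<mu> / (3 - 4 * \<mu>)" using above[of \<mu>] \<mu> \<open>m = 0\<close> by simp
    qed simp
  qed simp
  then have "M = 0" using nonneg by simp
  then show ?thesis
    using tendsto_zero_of_eventual_bound[OF C] \<open>m = 0\<close> by (simp add: M_def m_def)
qed

end

section \<open>Reduction to the linear and the normalized Moebius comparison\<close>

theorem theorem1p3:
  fixes f :: "real \<Rightarrow> real"
  assumes C3: "Ck 3 f"
    and feedback: "\<And>x. x \<noteq> 0 \<Longrightarrow> x * f x < 0"
    and slope_neg: "deriv f 0 < 0"
    and bounded_below: "bdd_below (range f)"
    and crit_unique: "\<And>x y. critical_point f x \<Longrightarrow> critical_point f y \<Longrightarrow> x = y"
    and crit_extremum: "\<And>x. critical_point f x \<Longrightarrow> local_extremum f x"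
    and schwarz_neg: "\<And>x. \<not> critical_point f x \<Longrightarrow> schwarz_derivative f x < 0"
    and slope_bound: "- deriv f 0 \<le> 3 / 2"
  shows "\<forall>\<gamma> x. continuous_on {-1..0} \<gamma> \<longrightarrow> dde_solution f \<gamma> x \<longrightarrow> (x \<longlongrightarrow> 0) at_top"
proof (intro allI impI)
  fix \<gamma> x assume sol: "dde_solution f \<gamma> x"
  interpret delay_equation f x
  proof
    show "continuous_on UNIV f"
      using C3 unfolding Ck_def
      by (intro continuous_at_imp_continuous_on ballI field_differentiable_imp_continuous_at)
         (auto dest: spec[of _ 0])
    show "(x has_real_derivative f (x (t - 1))) (at t)" if "0 < t" for t
    proof -
      have "(x has_real_derivative f (x (t - 1))) (at t within {0..})"
        using sol that by (simp add: dde_solution_def)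
      then show ?thesis using that at_within_interior[of t "{0..}"] by (simp add: interior_real_atLeast)
    qed
  qed (rule feedback)
  define c where "c = - (deriv ^^ 2) f 0 / (2 * deriv f 0)"
  have cmp: "0 < y * (f y + 3/2 * (y / (1 + c * y)))" if "y \<noteq> 0" "0 < 1 + c * y" for y
    using schwarz_comparison[OF C3 g_zero slope_neg slope_bound crit_unique crit_extremum schwarz_neg c_def] that
    by blast
  show "(x \<longlongrightarrow> 0) at_top"
  proof (rule disjE[OF tendsto_zero_or_zeros])
    assume "\<forall>T. \<exists>t\<ge>T. x t = 0"
    then interpret oscillating_delay_equation f x
      by unfold_locales auto
    show ?thesis
    proof (cases "c = 0")
      case True
      then show ?thesis using tendsto_zero_of_linear[OF _ bounded_below] cmp by simp
    next
      case False
      then interpret scaled: oscillating_delay_equation "\<lambda>y. c * f (y / c)" "\<lambda>t. c * x t"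
        by (rule scale_oscillating)
      have "((\<lambda>t. c * x t) \<longlongrightarrow> 0) at_top"
      proof (rule scaled.tendsto_zero_of_moebius)
        fix y :: real assume y: "y \<noteq> 0" "0 < 1 + y"
        \<comment> \<open>\<open>cmp\<close> at \<open>y / c\<close>, where
          \<open>1 + c * (y / c) = 1 + y\<close>; the factor \<open>c\<^sup>2\<close> is positive
          for either sign of \<open>c\<close>.\<close>
        have "0 < c\<^sup>2 * (y / c * (f (y / c) + 3/2 * (y / c / (1 + c * (y / c)))))"
          by (intro mult_pos_pos[OF _ cmp[of "y / c"]]) (use y False in auto)
        also have "\<dots> = y * (c * f (y / c) + 3/2 * (y / (1 + y)))"
          using False y by (simp add: power2_eq_square divide_simps)
        finally show "0 < y * (c * f (y / c) + 3/2 * (y / (1 + y)))" .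
      qed
      then show ?thesis using tendsto_mult_left_iff[OF False, of x 0 at_top] by simp
    qed
  qed
qed

end
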